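(* Let $\mathbb{P}$ be a Feller transition kernel on $E$. Fix $\bar x\in E$, $\eta>1$ and $m\in\mathbb{N}$, let $B:=B(\bar x,\eta)$ and $g_m(x):=\left[m\cdot\rho\left(x,B(\bar x,\eta-\tfrac1m)\right)\right]\wedge 1$. Assume that $g_m$ admits a generic (i.e. not necessarily bounded) solution $(w_m,\lambda_m)$ of the Multiplicative Poisson Equation, and that $$\lambda_m<1,\qquad \sup_{n\in\mathbb{N}}\ \inf_{x\in E}\ \mathbb{P}_x\left[\exists\, s\in\mathbb{N},\ s\le n:\ x_s\in B\right]=0 .$$ Then the function $w_m$ is unbounded.
   Context: $(E,\mathcal{E})$ is a locally compact separable metric space with metric $\rho$ and Borel $\sigma$-field $\mathcal{E}$; $B(x,\epsilon):=\{y\in E:\rho(x,y)\le\epsilon\}$, $\rho(x,A):=\inf_{y\in A}\rho(x,y)$, $a\wedge b:=\min(a,b)$, $\mathbb{N}=\{1,2,\ldots\}$. $C(E)$ is the space of continuous bounded functions $E\to\mathbb{R}$. A Feller transition kernel $\mathbb{P}$ on $E$ is a probability transition kernel such that $x\mapsto\int_E f(y)\,\mathbb{P}(x,dy)$ is continuous for every $f\in C(E)$. $\mathbb{P}_x$ is the law of the Markov process $(x_i)_{i\ge0}$ with kernel $\mathbb{P}$ and $x_0=x$. A generic solution of the Multiplicative Poisson Equation (MPE) for $g\in C(E)$ is a pair $(w,\lambda)$ with $\lambda\in\mathbb{R}$ and $w:E\to\mathbb{R}$ a measurable function, not necessarily bounded, such that $\int_E e^{w(y)}\,\mathbb{P}(x,dy)<\infty$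 and $$w(x)=g(x)-\lambda+\ln\int_E e^{w(y)}\,\mathbb{P}(x,dy),\quad x\in E.$$ *)

theory Defs
  imports "HOL-Probability.Probability"
begin

definition feller_kernel :: "('a::metric_space \<Rightarrow> 'a measure) \<Rightarrow> bool" where
  "feller_kernel K \<longleftrightarrow>
     K \<in> measurable borel (prob_algebra borel) \<and>
     (\<forall>f \<in> bcontfun. continuous_on UNIV (\<lambda>x. \<integral>y. (f y :: real) \<partial>K x))"

text \<open>
  The law on path space of the Markov process with kernel \<open>K\<close> started at \<open>x\<close> is obtained from
  the Ionescu-Tulcea construction: the coordinate at time \<open>0\<close> has distribution \<open>return borel x\<close>,
  and given the coordinates at times \<open>0, \<dots>, n\<close> the one at time \<open>Suc n\<close> has distribution
  \<open>K (\<omega> n)\<close>.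
\<close>

primrec markov_step :: "('a::topological_space \<Rightarrow> 'a measure) \<Rightarrow> 'a \<Rightarrow> nat \<Rightarrow> (nat \<Rightarrow> 'a) \<Rightarrow> 'a measure"
  where
  "markov_step K x 0 = (\<lambda>\<omega>. return borel x)"
| "markov_step K x (Suc n) = (\<lambda>\<omega>. K (\<omega> n))"

definition markov_law :: "('a::topological_space \<Rightarrow> 'a measure) \<Rightarrow> 'a \<Rightarrow> (nat \<Rightarrow> 'a) measure" where
  "markov_law K x =
     projective_family.lim UNIV (Ionescu_Tulcea.CI (markov_step K x) (\<lambda>_. borel)) (\<lambda>_. borel)"

lemma Ionescu_Tulcea_markov_step:
  fixes K :: "'a::topological_space \<Rightarrow> 'a measure"
  assumes K: "K \<in> measurable borel (prob_algebra borel)"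
  shows "Ionescu_Tulcea (markov_step K x) (\<lambda>_. borel)"
proof (rule Ionescu_Tulcea.intro)
  have K': "K \<in> measurable borel (subprob_algebra borel)"
    using K by (rule measurable_prob_algebraD)
  show "markov_step K x i \<in> measurable (PiM {0..<i} (\<lambda>_. borel)) (subprob_algebra borel)" for i
  proof (cases i)
    case 0
    then show ?thesis
      by (simp add: space_subprob_algebra prob_space_imp_subprob_space prob_space_return)
  next
    case (Suc n)
    have "(\<lambda>\<omega>. \<omega> n) \<in> measurable (PiM {0..<Suc n} (\<lambda>_. borel)) (borel :: 'a measure)"
      by (rule measurable_component_singleton) simp
    from measurable_compose[OF this K'] show ?thesis
      by (simp add: Suc)
  qed
  have "prob_space (K y)" for y
    using measurable_space[OF K, of y] by (simp add: space_prob_algebra)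
  then show "prob_space (markov_step K x i \<omega>)" for i and \<omega> :: "nat \<Rightarrow> 'a"
    by (cases i) (simp_all add: prob_space_return)
qed

lemma
  fixes K :: "'a::topological_space \<Rightarrow> 'a measure"
  assumes K: "K \<in> measurable borel (prob_algebra borel)"
  shows prob_space_markov_law: "prob_space (markov_law K x)"
    and sets_markov_law: "sets (markov_law K x) = sets (PiM UNIV (\<lambda>_. borel))"
proof -
  interpret Ionescu_Tulcea "markov_step K x" "\<lambda>_. borel"
    by (rule Ionescu_Tulcea_markov_step[OF K])
  show "prob_space (markov_law K x)"
  proof
    let ?S = "space (PiM {} (\<lambda>_. borel)) :: (nat \<Rightarrow> 'a) set"
    have "emeasure PF.lim (PF.emb UNIV {} ?S) = emeasure (CI {}) ?S"
      by (rule lim) auto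
    also have "\<dots> = 1"
      using prob_space.emeasure_space_1[OF PF.prob_space_P[of "{}"]] by (simp add: CI_def)
    also have "PF.emb UNIV {} ?S = space PF.lim"
      by (auto simp: prod_emb_def space_PiM)
    finally show "emeasure (markov_law K x) (space (markov_law K x)) = 1"
      by (simp add: markov_law_def)
  qed
  show "sets (markov_law K x) = sets (PiM UNIV (\<lambda>_. borel))"
    unfolding markov_law_def by simp
qed

text \<open>
  \<open>integrable\<close> renders \<open>\<integral> e\<^sup>w dK x < \<infinity>\<close>, as the integrand is positive; in particular
  the Bochner integral below has no junk value.
\<close>

definition generic_MPE_solution ::
  "('a::topological_space \<Rightarrow> 'a measure) \<Rightarrow> ('a \<Rightarrow> real) \<Rightarrow> ('a \<Rightarrow> real) \<Rightarrow> real \<Rightarrow> bool" where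
  "generic_MPE_solution K g w l \<longleftrightarrow>
     w \<in> borel_measurable borel \<and>
     (\<forall>x. integrable (K x) (\<lambda>y. exp (w y))) \<and>
     (\<forall>x. w x = g x - l + ln (\<integral>y. exp (w y) \<partial>K x))"

text \<open>
  \<open>infdist\<close> has the value \<open>0\<close> on the empty set, but for \<open>\<eta> > 1\<close> and \<open>m \<ge> 1\<close> the ball
  below contains its centre.
\<close>

definition exterior_cutoff :: "'a::metric_space \<Rightarrow> real \<Rightarrow> nat \<Rightarrow> 'a \<Rightarrow> real" where
  "exterior_cutoff c \<eta> m x = min (real m * infdist x (cball c (\<eta> - 1 / real m))) 1"

lemma exterior_cutoff_bcontfun: "exterior_cutoff c \<eta> m \<in> bcontfun"
proof -
  have "bounded (range (exterior_cutoff c \<eta> m))"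
    by (rule boundedI[where B = 1]) (auto simp: exterior_cutoff_def infdist_nonneg)
  then show ?thesis
    unfolding bcontfun_def by (auto simp: exterior_cutoff_def[abs_def] intro!: continuous_intros)
qed

end

theory Submission
  imports Defs
begin

text \<open>
  Write \<open>B = cball c \<eta>\<close> and \<open>u = exp w\<close>. The Poisson equation then reads
  \<open>u x = exp (g x - l) * \<integral>u dK x\<close>, and \<open>g = 1\<close> outside \<open>B\<close>, so that on each visit to the complement
  of \<open>B\<close> the mean of \<open>u\<close> after one further step is \<open>u\<close> divided by \<open>exp (1 - l) > 1\<close>. On paths
  that stay outside \<open>B\<close>, \<open>u\<close> therefore decays geometrically on average: up to a constant factor,
  \<open>exp (1 - l) ^ n * E\<^sub>x [u (x\<^sub>n); x\<^sub>1, \<dots>, x\<^sub>n \<notin> B] \<le> u x\<close> (lemma \<open>superharmonic_ge_staying\<close>).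

  If \<open>w\<close> were bounded, \<open>u\<close> would lie between two positive constants, and the probability of staying
  outside \<open>B\<close> up to time \<open>n\<close> would tend to \<open>0\<close> geometrically, uniformly in the starting point
  (lemma \<open>bounded_MPE_solution_staying_bound\<close>). But for each \<open>n\<close> the hypothesis provides starting
  points from which \<open>B\<close> is hit up to time \<open>n\<close> with probability less than \<open>1 / 2\<close>.
\<close>

section \<open>The path space law one step at a time\<close>

text \<open>
  The measures \<open>C 0 n\<close> of the Ionescu-Tulcea construction are built by appending one coordinate at a
  time; identifying them with the marginals of the path law makes that recursion available for
  \<^const>\<open>markov_law\<close>.
\<close>

lemma nn_integral_markov_law_finite_dim:
  fixes K :: "'a::topological_space \<Rightarrow> 'a measure"
  assumes K: "K \<in> measurable borel (prob_algebra borel)"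
    and f: "f \<in> borel_measurable (PiM {0..<n} (\<lambda>_. borel))"
  shows "(\<integral>\<^sup>+\<omega>. f (restrict \<omega> {0..<n}) \<partial>markov_law K x) =
    (\<integral>\<^sup>+\<omega>. f \<omega> \<partial>Ionescu_Tulcea.C (markov_step K x) (\<lambda>_. borel) 0 n (\<lambda>_. undefined))"
proof -
  interpret Ionescu_Tulcea "markov_step K x" "\<lambda>_. borel"
    by (rule Ionescu_Tulcea_markov_step[OF K])
  let ?P = "PiM {0..<n} (\<lambda>_. borel) :: (nat \<Rightarrow> 'a) measure"
  let ?C = "C 0 n (\<lambda>_. undefined)"
  have sets_C': "sets ?C = sets ?P"
    using sets_C[of "\<lambda>_. undefined" 0 n] by (simp add: space_PiM)
  have restr: "(\<lambda>\<omega>. restrict \<omega> {0..<n}) \<in> measurable (markov_law K x) ?P"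
    using measurable_restrict_subset[of "{0..<n}" UNIV "\<lambda>_. borel"]
    by (simp add: measurable_cong_sets[OF sets_markov_law[OF K] refl])
  have "distr (markov_law K x) ?P (\<lambda>\<omega>. restrict \<omega> {0..<n}) = ?C"
  proof (rule measure_eqI)
    fix X assume "X \<in> sets (distr (markov_law K x) ?P (\<lambda>\<omega>. restrict \<omega> {0..<n}))"
    then have X: "X \<in> sets ?P" by simp
    have "emeasure (distr (markov_law K x) ?P (\<lambda>\<omega>. restrict \<omega> {0..<n})) X =
        emeasure PF.lim (PF.emb UNIV {0..<n} X)"
      using X restr
      by (simp add: emeasure_distr markov_law_def prod_emb_def space_PiM vimage_def)
    also have "\<dots> = emeasure (CI {0..<n}) X"
      using X by (intro lim) auto
    also have "\<dots> = emeasure ?C (PF.emb {0..<n} {0..<n} X)"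
      using X by (intro emeasure_CI) auto
    also have "PF.emb {0..<n} {0..<n} X = X"
      using sets.sets_into_space[OF X] by (intro prod_emb_id) (simp add: space_PiM)
    finally show "emeasure (distr (markov_law K x) ?P (\<lambda>\<omega>. restrict \<omega> {0..<n})) X =
      emeasure ?C X" .
  qed (simp add: sets_C')
  then show ?thesis
    using nn_integral_distr[OF restr, of f] f by (simp add: measurable_cong_sets[OF sets_C' refl])
qed

lemma nn_integral_markov_law_0:
  fixes K :: "'a::topological_space \<Rightarrow> 'a measure"
  assumes K: "K \<in> measurable borel (prob_algebra borel)"
    and h[measurable]: "h \<in> borel_measurable borel"
  shows "(\<integral>\<^sup>+\<omega>. h (\<omega> 0) \<partial>markov_law K x) = h x"
proof -
  interpret Ionescu_Tulcea "markov_step K x" "\<lambda>_. borel"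
    by (rule Ionescu_Tulcea_markov_step[OF K])
  have und: "(\<lambda>_. undefined) \<in> space (PiM {0..<0::nat} (\<lambda>_. borel :: 'a measure))"
    by (simp add: space_PiM)
  have m: "(\<lambda>\<omega>. h (\<omega> 0)) \<in> borel_measurable (PiM {0..<Suc 0} (\<lambda>_. borel))"
    by measurable
  have "(\<integral>\<^sup>+\<omega>. h (\<omega> 0) \<partial>markov_law K x) =
      (\<integral>\<^sup>+\<omega>. h (\<omega> 0) \<partial>C 0 (Suc 0) (\<lambda>_. undefined))"
    using nn_integral_markov_law_finite_dim[OF K m, of x] by simp
  also have "C 0 (Suc 0) (\<lambda>_. undefined) = eP 0 (\<lambda>_. undefined)"
    using bind_return[OF measurable_eP und] by simp
  also have "(\<integral>\<^sup>+\<omega>. h (\<omega> 0) \<partial>\<dots>) = h x"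
    by (subst nn_integral_eP[OF und m]) (simp add: nn_integral_return)
  finally show ?thesis .
qed

text \<open>
  The one-step Markov property: conditionally on the coordinates up to time \<open>n\<close>, the next one has
  law \<open>K (\<omega> n)\<close>. It is stated for the last step, because the path law extends at its end; restarting
  the chain after its first step would require a shift of the path space.
\<close>

lemma nn_integral_markov_law_Suc:
  fixes K :: "'a::topological_space \<Rightarrow> 'a measure"
  assumes K: "K \<in> measurable borel (prob_algebra borel)"
    and \<phi>[measurable]: "\<phi> \<in> borel_measurable (PiM {0..<Suc n} (\<lambda>_. borel))"
    and h[measurable]: "h \<in> borel_measurable borel"
  shows "(\<integral>\<^sup>+\<omega>. \<phi> (restrict \<omega> {0..<Suc n}) * h (\<omega> (Suc n)) \<partial>markov_law K x) =
    (\<integral>\<^sup>+\<omega>. \<phi> (restrict \<omega> {0..<Suc n}) * (\<integral>\<^sup>+y. h y \<partial>K (\<omega> n)) \<partial>markov_law K x)"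
proof -
  interpret Ionescu_Tulcea "markov_step K x" "\<lambda>_. borel"
    by (rule Ionescu_Tulcea_markov_step[OF K])
  have K'[measurable]: "K \<in> measurable borel (subprob_algebra borel)"
    using K by (rule measurable_prob_algebraD)
  have sets_K: "sets (K y) = sets borel" for y
    using subprob_measurableD(2)[OF K', of y] by simp
  let ?P = "\<lambda>n. PiM {0..<n} (\<lambda>_. borel) :: (nat \<Rightarrow> 'a) measure"
  let ?C = "\<lambda>n. C 0 n (\<lambda>_. undefined)"
  have und: "(\<lambda>_. undefined) \<in> space (?P 0)"
    by (simp add: space_PiM)
  have restr: "(\<lambda>\<omega>. restrict \<omega> {0..<Suc n}) \<in> measurable (?P (Suc (Suc n))) (?P (Suc n))"
    by (rule measurable_restrict_subset) auto
  have m1: "(\<lambda>\<omega>. \<phi> (restrict \<omega> {0..<Suc n}) * h (\<omega> (Suc n)))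
      \<in> borel_measurable (?P (Suc (Suc n)))"
    using measurable_compose[OF restr \<phi>] by measurable
  have m2: "(\<lambda>\<omega>. \<phi> \<omega> * (\<integral>\<^sup>+y. h y \<partial>K (\<omega> n))) \<in> borel_measurable (?P (Suc n))"
    by measurable
  have meas_eP: "eP (Suc n) \<in> measurable (?C (Suc n)) (subprob_algebra (?P (Suc (Suc n))))"
    unfolding measurable_cong_sets[OF sets_C[OF und, of "Suc n", unfolded add_0] refl]
    by (rule measurable_eP)
  have spC: "space (?C k) = space (?P k)" for k
    using space_C[OF und, of k] by simp
  have "(\<integral>\<^sup>+\<omega>. \<phi> (restrict \<omega> {0..<Suc n}) * h (\<omega> (Suc n)) \<partial>markov_law K x) =
      (\<integral>\<^sup>+\<omega>. \<phi> (restrict \<omega> {0..<Suc n}) * h (\<omega> (Suc n)) \<partial>?C (Suc (Suc n)))"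
    using nn_integral_markov_law_finite_dim[OF K m1, of x]
    by (simp add: Int_absorb1 ivl_subset)
  also have "\<dots> = (\<integral>\<^sup>+\<omega>. (\<integral>\<^sup>+\<omega>'. \<phi> (restrict \<omega>' {0..<Suc n}) * h (\<omega>' (Suc n)) \<partial>eP (Suc n) \<omega>)
      \<partial>?C (Suc n))"
    unfolding C.simps(2)[of _ "Suc n"] add_0
    by (rule nn_integral_bind[OF m1 meas_eP])
  also have "\<dots> = (\<integral>\<^sup>+\<omega>. \<phi> \<omega> * (\<integral>\<^sup>+y. h y \<partial>K (\<omega> n)) \<partial>?C (Suc n))"
  proof (rule nn_integral_cong)
    fix \<omega> assume "\<omega> \<in> space (?C (Suc n))"
    then have \<omega>: "\<omega> \<in> space (?P (Suc n))" by (simp only: spC)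
    have r: "restrict (fun_upd \<omega> (Suc n) y) {0..<Suc n} = \<omega>" for y
      using \<omega> by (auto simp: space_PiM PiE_iff extensional_def restrict_def)
    have "(\<integral>\<^sup>+\<omega>'. \<phi> (restrict \<omega>' {0..<Suc n}) * h (\<omega>' (Suc n)) \<partial>eP (Suc n) \<omega>) =
        (\<integral>\<^sup>+y. \<phi> \<omega> * h y \<partial>K (\<omega> n))"
      unfolding nn_integral_eP[OF \<omega> m1] r by simp
    also have "\<dots> = \<phi> \<omega> * (\<integral>\<^sup>+y. h y \<partial>K (\<omega> n))"
      by (intro nn_integral_cmult) (simp add: measurable_cong_sets[OF sets_K refl])
    finally show "(\<integral>\<^sup>+\<omega>'. \<phi> (restrict \<omega>' {0..<Suc n}) * h (\<omega>' (Suc n)) \<partial>eP (Suc n) \<omega>) =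
      \<phi> \<omega> * (\<integral>\<^sup>+y. h y \<partial>K (\<omega> n))" .
  qed
  also have "\<dots> = (\<integral>\<^sup>+\<omega>. \<phi> (restrict \<omega> {0..<Suc n}) * (\<integral>\<^sup>+y. h y \<partial>K (\<omega> n)) \<partial>markov_law K x)"
    using nn_integral_markov_law_finite_dim[OF K m2, of x] by simp
  finally show ?thesis .
qed

section \<open>Superharmonic functions along paths that stay in a set\<close>

text \<open>
  Each step taken from a point of \<open>A\<close> contributes one factor \<open>r\<close>. The starting point need not lie in \<open>A\<close>; the first step
  only contributes the factor \<open>a\<close>. This is why \<open>n\<close> powers of \<open>r\<close> go with \<open>Suc n\<close> steps.
\<close>

lemma superharmonic_ge_staying:
  fixes K :: "'a::topological_space \<Rightarrow> 'a measure" and u :: "'a \<Rightarrow> ennreal"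
  assumes K: "K \<in> measurable borel (prob_algebra borel)"
    and A[measurable]: "A \<in> sets borel"
    and u[measurable]: "u \<in> borel_measurable borel"
    and ge_a: "\<And>y. a * (\<integral>\<^sup>+z. u z \<partial>K y) \<le> u y"
    and ge_r: "\<And>y. y \<in> A \<Longrightarrow> r * (\<integral>\<^sup>+z. u z \<partial>K y) \<le> u y"
  shows "a * r ^ n * (\<integral>\<^sup>+\<omega>. indicator {\<omega>. \<forall>s\<in>{1..Suc n}. \<omega> s \<in> A} \<omega> * u (\<omega> (Suc n)) \<partial>markov_law K x)
    \<le> u x"
proof -
  have K'[measurable]: "K \<in> measurable borel (subprob_algebra borel)"
    using K by (rule measurable_prob_algebraD)
  note sets_markov_law[OF K, of x, measurable_cong]
  define I where "I n = (\<lambda>\<omega>::nat \<Rightarrow> 'a. indicator {\<omega>. \<forall>s\<in>{1..n}. \<omega> s \<in> A} \<omega> :: ennreal)" for n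
  have I_measurable[measurable]: "I k \<in> borel_measurable (PiM J (\<lambda>_. borel))" if "{1..k} \<subseteq> J" for k J
  proof -
    have "{\<omega> \<in> space (PiM J (\<lambda>_. borel)). \<forall>s\<in>{1..k}. \<omega> s \<in> A} \<in> sets (PiM J (\<lambda>_. borel))"
      using that by (intro sets.sets_Collect_finite_All) auto
    then show ?thesis
      unfolding I_def by (subst borel_measurable_indicator_iff) (simp add: Int_def conj_commute)
  qed
  have I_markov_law: "I k \<in> borel_measurable (markov_law K x)" for k
    using I_measurable[of k UNIV] by (simp add: measurable_cong_sets[OF sets_markov_law[OF K] refl])
  have coordinate: "(\<lambda>\<omega>. \<omega> k) \<in> measurable (markov_law K x) borel" for k
    using measurable_component_singleton[of k UNIV "\<lambda>_. borel"]
    by (simp add: measurable_cong_sets[OF sets_markov_law[OF K] refl])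
  have Ku: "(\<lambda>y. \<integral>\<^sup>+z. u z \<partial>K y) \<in> borel_measurable borel"
    by measurable
  have I_restrict: "I n (restrict \<omega> {0..<Suc n}) = I n \<omega>" for n \<omega>
    by (simp add: I_def indicator_def)
  have I_Suc: "I (Suc n) \<omega> = I n \<omega> * indicator A (\<omega> (Suc n))" for n \<omega>
    by (auto simp: I_def atLeastAtMostSuc_conv split: split_indicator)
  have step: "(\<integral>\<^sup>+\<omega>. I (Suc n) \<omega> * u (\<omega> (Suc n)) \<partial>markov_law K x)
      \<le> (\<integral>\<^sup>+\<omega>. I n \<omega> * (\<integral>\<^sup>+z. u z \<partial>K (\<omega> n)) \<partial>markov_law K x)" for n
  proof -
    have "(\<integral>\<^sup>+\<omega>. I (Suc n) \<omega> * u (\<omega> (Suc n)) \<partial>markov_law K x)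
        \<le> (\<integral>\<^sup>+\<omega>. I n \<omega> * u (\<omega> (Suc n)) \<partial>markov_law K x)"
      by (intro nn_integral_mono) (auto simp: I_Suc split: split_indicator)
    also have "\<dots> = (\<integral>\<^sup>+\<omega>. I n \<omega> * (\<integral>\<^sup>+z. u z \<partial>K (\<omega> n)) \<partial>markov_law K x)"
      using nn_integral_markov_law_Suc[OF K I_measurable u, of n n x] unfolding I_restrict by force
    finally show ?thesis .
  qed
  have "a * r ^ n * (\<integral>\<^sup>+\<omega>. I (Suc n) \<omega> * u (\<omega> (Suc n)) \<partial>markov_law K x) \<le> u x"
  proof (induction n)
    case 0
    have "a * (\<integral>\<^sup>+\<omega>. I (Suc 0) \<omega> * u (\<omega> (Suc 0)) \<partial>markov_law K x)
        \<le> a * (\<integral>\<^sup>+\<omega>. (\<integral>\<^sup>+z. u z \<partial>K (\<omega> 0)) \<partial>markov_law K x)"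
      using step[of 0] by (intro mult_left_mono) (auto simp: I_def)
    also have "\<dots> = a * (\<integral>\<^sup>+z. u z \<partial>K x)"
      by (subst nn_integral_markov_law_0[OF K]) auto
    also have "\<dots> \<le> u x" by (rule ge_a)
    finally show ?case by simp
  next
    case (Suc n)
    have "r * (\<integral>\<^sup>+\<omega>. I (Suc (Suc n)) \<omega> * u (\<omega> (Suc (Suc n))) \<partial>markov_law K x)
        \<le> r * (\<integral>\<^sup>+\<omega>. I (Suc n) \<omega> * (\<integral>\<^sup>+z. u z \<partial>K (\<omega> (Suc n))) \<partial>markov_law K x)"
      by (intro mult_left_mono step) auto
    also have "\<dots> = (\<integral>\<^sup>+\<omega>. r * (I (Suc n) \<omega> * (\<integral>\<^sup>+z. u z \<partial>K (\<omega> (Suc n)))) \<partial>markov_law K x)"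
      by (intro nn_integral_cmult[symmetric] borel_measurable_times_ennreal I_markov_law
          measurable_compose[OF coordinate Ku])
    also have "\<dots> \<le> (\<integral>\<^sup>+\<omega>. I (Suc n) \<omega> * u (\<omega> (Suc n)) \<partial>markov_law K x)"
      using ge_r
      by (intro nn_integral_mono)
         (auto simp: I_Suc mult.left_commute[of r] intro!: mult_left_mono split: split_indicator)
    finally have "a * r ^ n * (r * (\<integral>\<^sup>+\<omega>. I (Suc (Suc n)) \<omega> * u (\<omega> (Suc (Suc n))) \<partial>markov_law K x))
        \<le> a * r ^ n * (\<integral>\<^sup>+\<omega>. I (Suc n) \<omega> * u (\<omega> (Suc n)) \<partial>markov_law K x)"
      by (intro mult_left_mono) auto
    also have "\<dots> \<le> u x" by (rule Suc.IH)
    finally show ?case by (simp add: mult_ac)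
  qed
  then show ?thesis by (simp add: I_def)
qed

section \<open>The multiplicative Poisson equation\<close>

text \<open>
  Exponentiating the Poisson equation turns it into a linear eigenvalue-type equation for \<open>exp w\<close>.
  The logarithm can be undone because the integral of a positive function against a probability
  measure is positive.
\<close>

lemma generic_MPE_solution_exp:
  fixes K :: "'a::topological_space \<Rightarrow> 'a measure"
  assumes K: "K \<in> measurable borel (prob_algebra borel)"
    and sol: "generic_MPE_solution K g w l"
  shows "ennreal (exp (w x)) = ennreal (exp (g x - l)) * (\<integral>\<^sup>+y. ennreal (exp (w y)) \<partial>K x)"
proof -
  interpret prob_space "K x"
    using measurable_space[OF K, of x] by (simp add: space_prob_algebra)
  have int: "integrable (K x) (\<lambda>y. exp (w y))"
    and eq: "w x = g x - l + ln (\<integral>y. exp (w y) \<partial>K x)"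
    using sol unfolding generic_MPE_solution_def by blast+
  have "(\<integral>y. exp (w y) \<partial>K x) \<noteq> 0"
  proof
    assume "(\<integral>y. exp (w y) \<partial>K x) = 0"
    then have "AE y in K x. exp (w y) = 0"
      using integral_nonneg_eq_0_iff_AE[OF int] by simp
    then show False by simp
  qed
  moreover have "0 \<le> (\<integral>y. exp (w y) \<partial>K x)" by simp
  ultimately have pos: "0 < (\<integral>y. exp (w y) \<partial>K x)" by linarith
  have "exp (w x) = exp (g x - l) * (\<integral>y. exp (w y) \<partial>K x)"
    using arg_cong[OF eq, of exp] pos by (simp only: exp_add exp_ln)
  then show ?thesis
    using nn_integral_eq_integral[OF int] pos by (simp add: ennreal_mult)
qed

text \<open>
  By the triangle inequality a point outside the ball of radius \<open>\<eta>\<close> has distance at least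
  \<open>1 / m\<close> from the concentric ball of radius \<open>\<eta> - 1 / m\<close>. The bounds on \<open>\<eta>\<close> and \<open>m\<close> exclude that the
  smaller ball is empty, where \<^const>\<open>infdist\<close> would be \<open>0\<close>.
\<close>

lemma exterior_cutoff_eq_1:
  assumes "\<eta> > 1" "m \<ge> 1" "x \<notin> cball c \<eta>"
  shows "exterior_cutoff c \<eta> m x = 1"
proof -
  have m: "1 / real m \<le> 1" "real m > 0" using assms by auto
  have "c \<in> cball c (\<eta> - 1 / real m)" using assms(1) m(1) by simp
  moreover have "1 / real m \<le> dist x y" if "y \<in> cball c (\<eta> - 1 / real m)" for y
    using that assms(3) dist_triangle[of c x y] by (simp add: dist_commute)
  ultimately have "1 / real m \<le> infdist x (cball c (\<eta> - 1 / real m))"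
    unfolding infdist_def by (auto intro!: cINF_greatest)
  then have "1 \<le> real m * infdist x (cball c (\<eta> - 1 / real m))"
    using m by (simp add: field_simps)
  then show ?thesis by (simp add: exterior_cutoff_def)
qed

text \<open>
  Here \<open>exp w\<close> is superharmonic in the above sense with the factor \<open>exp (- l)\<close> everywhere and
  \<open>exp (1 - l)\<close> on \<open>A\<close>. Bounding it by \<open>exp (- M)\<close> from below at the end of the path and by \<open>exp M\<close>
  from above at its start leaves a bound on the probability alone.
\<close>

lemma bounded_MPE_solution_staying_bound:
  fixes K :: "'a::topological_space \<Rightarrow> 'a measure"
  assumes K: "K \<in> measurable borel (prob_algebra borel)"
    and A[measurable]: "A \<in> sets borel"
    and sol: "generic_MPE_solution K g w l"
    and g_nonneg: "\<And>y. 0 \<le> g y" and g_ge_1: "\<And>y. y \<in> A \<Longrightarrow> 1 \<le> g y"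
    and M: "\<And>y. \<bar>w y\<bar> \<le> M"
  shows "exp (1 - l) ^ n *
      measure (markov_law K x) {\<omega> \<in> space (markov_law K x). \<forall>s\<in>{1..Suc n}. \<omega> s \<in> A}
    \<le> exp (2 * M + l)"
proof -
  let ?S = "{\<omega> \<in> space (markov_law K x). \<forall>s\<in>{1..Suc n}. \<omega> s \<in> A}"
  let ?u = "\<lambda>y. ennreal (exp (w y))"
  interpret prob_space "markov_law K x" by (rule prob_space_markov_law[OF K])
  note sets_markov_law[OF K, of x, measurable_cong]
  have [measurable]: "w \<in> borel_measurable borel"
    using sol unfolding generic_MPE_solution_def by blast
  have S: "?S \<in> sets (markov_law K x)"
    by (intro sets.sets_Collect_finite_All) auto
  have low: "ennreal (exp (- M)) \<le> ?u y" for y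
    using M[of y] by (intro ennreal_leI) simp
  have scale: "ennreal (exp k) * (\<integral>\<^sup>+z. ?u z \<partial>K y) \<le> ?u y" if "k \<le> g y - l" for k y
    unfolding generic_MPE_solution_exp[OF K sol, of y]
    using that by (intro mult_right_mono ennreal_leI) auto
  have "ennreal (exp (- M)) * emeasure (markov_law K x) ?S =
      (\<integral>\<^sup>+\<omega>. ennreal (exp (- M)) * indicator ?S \<omega> \<partial>markov_law K x)"
    using S by (simp add: nn_integral_cmult_indicator)
  also have "\<dots> \<le> (\<integral>\<^sup>+\<omega>. indicator {\<omega>. \<forall>s\<in>{1..Suc n}. \<omega> s \<in> A} \<omega> * ?u (\<omega> (Suc n)) \<partial>markov_law K x)"
    using low by (intro nn_integral_mono) (auto split: split_indicator)
  finally have "ennreal (exp (- l)) * ennreal (exp (1 - l)) ^ n *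
      (ennreal (exp (- M)) * emeasure (markov_law K x) ?S)
    \<le> ennreal (exp (- l)) * ennreal (exp (1 - l)) ^ n *
      (\<integral>\<^sup>+\<omega>. indicator {\<omega>. \<forall>s\<in>{1..Suc n}. \<omega> s \<in> A} \<omega> * ?u (\<omega> (Suc n)) \<partial>markov_law K x)"
    by (intro mult_left_mono) auto
  also have "\<dots> \<le> ?u x"
    using g_nonneg g_ge_1 by (intro superharmonic_ge_staying[OF K A] scale) auto
  finally have "exp (- l) * exp (1 - l) ^ n * (exp (- M) * prob ?S) \<le> exp (w x)"
    by (simp add: emeasure_eq_measure ennreal_power flip: ennreal_mult)
  also have "\<dots> \<le> exp M" using M[of x] by simp
  finally have "exp (- l) * exp (1 - l) ^ n * (exp (- M) * prob ?S) \<le> exp M" .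
  moreover have exp_sum: "exp (2 * M + l) = exp M * (exp M * exp l)"
    by (simp flip: exp_add)
  ultimately show ?thesis
    using exp_sum by (simp add: exp_minus field_simps)
qed

theorem corollary6p4:
  fixes K :: "'a::metric_space \<Rightarrow> 'a measure"
    and c :: 'a and \<eta> :: real and m :: nat
    and w :: "'a \<Rightarrow> real" and l :: real
  assumes "locally_compact_space (euclidean :: 'a topology)"
    and "separable_space (euclidean :: 'a topology)"
    and "feller_kernel K"
    and "\<eta> > 1" and "m \<ge> 1"
    and "generic_MPE_solution K (exterior_cutoff c \<eta> m) w l"
    and "l < 1"
    and "(SUP n\<in>{1..}. INF x. measure (markov_law K x)
            {\<omega> \<in> space (markov_law K x). \<exists>s::nat. 1 \<le> s \<and> s \<le> n \<and> \<omega> s \<in> cball c \<eta>}) = 0"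
  shows "\<not> bounded (range w)"
proof
  assume "bounded (range w)"
  then obtain M where M: "\<And>y. \<bar>w y\<bar> \<le> M"
    by (auto simp: bounded_iff)
  have K: "K \<in> measurable borel (prob_algebra borel)"
    using assms(3) by (simp add: feller_kernel_def)
  let ?hit = "\<lambda>n x. {\<omega> \<in> space (markov_law K x). \<exists>s::nat. 1 \<le> s \<and> s \<le> n \<and> \<omega> s \<in> cball c \<eta>}"
  let ?A = "- cball c \<eta>"
  let ?stay = "\<lambda>n x. {\<omega> \<in> space (markov_law K x). \<forall>s\<in>{1..n}. \<omega> s \<in> ?A}"
  have A: "?A \<in> sets borel" by measurable
  have le_1: "measure (markov_law K x) X \<le> 1" for x X
    using prob_space.prob_le_1[OF prob_space_markov_law[OF K]] .
  (* The reals are only conditionally complete: the next two facts make the infimum and the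
     supremum in the hypothesis genuine, so that each infimum is at most 0. *)
  have bdd: "bdd_below (range (\<lambda>x. measure (markov_law K x) (?hit n x)))" for n
    by (rule bdd_belowI[where m = 0]) auto
  have bdd': "bdd_above ((\<lambda>n. INF x. measure (markov_law K x) (?hit n x)) ` {1..})"
    using le_1 by (intro bdd_aboveI2[where M = 1] cINF_lower2[OF bdd UNIV_I])
  have "exp (1 - l) ^ n \<le> 2 * exp (2 * M + l)" for n
  proof -
    have "(INF x. measure (markov_law K x) (?hit (Suc n) x)) \<le> 0"
      using cSUP_upper[OF _ bdd', of "Suc n"] assms(8) by simp
    then have "(INF x. measure (markov_law K x) (?hit (Suc n) x)) < 1 / 2"
      by simp
    then obtain x where x: "measure (markov_law K x) (?hit (Suc n) x) < 1 / 2"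
      using bdd by (subst (asm) cINF_less_iff) auto
    interpret prob_space "markov_law K x" by (rule prob_space_markov_law[OF K])
    note sets_markov_law[OF K, of x, measurable_cong]
    have S: "?stay (Suc n) x \<in> sets (markov_law K x)"
      by measurable
    have "?hit (Suc n) x = space (markov_law K x) - ?stay (Suc n) x"
      by auto
    then have half: "1 / 2 \<le> prob (?stay (Suc n) x)"
      using x prob_compl[OF S] by simp
    have cutoff: "0 \<le> exterior_cutoff c \<eta> m y" for y
      by (simp add: exterior_cutoff_def infdist_nonneg)
    have "exp (1 - l) ^ n * (1 / 2) \<le> exp (1 - l) ^ n * prob (?stay (Suc n) x)"
      using half by (intro mult_left_mono) auto
    also have "\<dots> \<le> exp (2 * M + l)"
      by (rule bounded_MPE_solution_staying_bound[OF K A assms(6) cutoff _ M])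
         (simp add: exterior_cutoff_eq_1[OF assms(4,5)])
    finally show ?thesis by simp
  qed
  moreover obtain n where "2 * exp (2 * M + l) < exp (1 - l) ^ n"
    using real_arch_pow[of "exp (1 - l)"] assms(7) by auto
  ultimately show False by (meson not_le)
qed

end
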